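(* Let $G$ be a connected graph (with at least two vertices) and let $k\in[1,\kappa(G)]$ be a real number. If there exists a minimum resolving function $g:V(G)\to[0,1]$ of $G$ such that $g(v)\le\frac1k$ for each $v\in V(G)$, then $\dim_f^k(G)=k\dim_f(G)$.
   Context: All graphs are finite, simple and undirected. $d(x,y)$ is the length of a shortest path between $x$ and $y$ in $G$. For distinct $x,y\in V(G)$, let $R\{x,y\}=\{z\in V(G): d(x,z)\neq d(y,z)\}$, and let $\kappa(G)=\min\{|R\{x,y\}|: x\neq y,\ x,y\in V(G)\}$. For a function $g$ on $V(G)$ and $U\subseteq V(G)$, write $g(U)=\sum_{s\in U}g(s)$. For a real number $k\in[1,\kappa(G)]$, a function $g:V(G)\to[0,1]$ is a $k$-resolving function of $G$ if $g(R\{x,y\})\ge k$ for any two distinct vertices $x,y\in V(G)$; the fractional $k$-metric dimension is $\dim_f^k(G)=\min\{g(V(G)): g \text{ is a } k\text{-resolving function of } G\}$. A resolving function is a $1$-resolving function, and the fractional metric dimension is $\dim_f(G)=\dim_f^1(G)$. A minimum resolving function is a resolving function $g$ with $g(V(G))=\dim_f(G)$. *)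

theory Defs
  imports "Graph_Theory.Graph_Theory" "HOL-Analysis.Analysis"
begin

text \<open>
  The graphs are those of the AFP entry Graph_Theory: the locale predicate \<open>graph G\<close> says that \<open>G\<close> is a finite
  symmetric digraph without loops and without parallel arcs, i.e. a finite simple undirected graph
  in which every edge is represented by its two orientations.
\<close>

text \<open>
  \<open>apath u p v\<close> says that \<open>p\<close> is the list of arcs of a path from \<open>u\<close> to \<open>v\<close>. The value is
  meaningful only if such a path exists, in particular in a connected graph.
\<close>

definition graph_dist :: "('a, 'b) pre_digraph \<Rightarrow> 'a \<Rightarrow> 'a \<Rightarrow> nat" where
  "graph_dist G x y = (LEAST n. \<exists>p. pre_digraph.apath G x p y \<and> length p = n)"

definition resolving_set :: "('a, 'b) pre_digraph \<Rightarrow> 'a \<Rightarrow> 'a \<Rightarrow> 'a set" where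
  "resolving_set G x y = {z \<in> verts G. graph_dist G x z \<noteq> graph_dist G y z}"

definition kappa :: "('a, 'b) pre_digraph \<Rightarrow> nat" where
  "kappa G = Min {card (resolving_set G x y) | x y. x \<in> verts G \<and> y \<in> verts G \<and> x \<noteq> y}"

definition k_resolving_function :: "('a, 'b) pre_digraph \<Rightarrow> real \<Rightarrow> ('a \<Rightarrow> real) \<Rightarrow> bool" where
  "k_resolving_function G k g \<longleftrightarrow>
     g \<in> verts G \<rightarrow> {0..1} \<and>
     (\<forall>x \<in> verts G. \<forall>y \<in> verts G. x \<noteq> y \<longrightarrow> k \<le> sum g (resolving_set G x y))"

text \<open>
  The minimum is written as an infimum of real numbers; the lemma \<open>k_metric_dim_attained\<close> below
  shows that for \<open>k\<close> in \<open>[1, kappa G]\<close> it is attained, hence a minimum.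
\<close>

definition frac_k_metric_dim :: "('a, 'b) pre_digraph \<Rightarrow> real \<Rightarrow> real" where
  "frac_k_metric_dim G k = Inf {sum g (verts G) | g. k_resolving_function G k g}"

abbreviation frac_metric_dim :: "('a, 'b) pre_digraph \<Rightarrow> real" where
  "frac_metric_dim G \<equiv> frac_k_metric_dim G 1"

abbreviation resolving_function :: "('a, 'b) pre_digraph \<Rightarrow> ('a \<Rightarrow> real) \<Rightarrow> bool" where
  "resolving_function G g \<equiv> k_resolving_function G 1 g"

definition minimum_resolving_function :: "('a, 'b) pre_digraph \<Rightarrow> ('a \<Rightarrow> real) \<Rightarrow> bool" where
  "minimum_resolving_function G g \<longleftrightarrow>
     resolving_function G g \<and> sum g (verts G) = frac_metric_dim G"

text \<open>\<open>graph_dist\<close> agrees with the shortest-path distance for unit weights.\<close>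

lemma (in fin_digraph) graph_dist_eq_mu:
  assumes "x \<rightarrow>\<^sup>* y"
  shows "ereal (real (graph_dist G x y)) = \<mu> (\<lambda>_. 1) x y"
proof -
  have cost: "awalk_cost (\<lambda>_. 1) p = real (length p)" for p :: "'b awalk"
    by (induction p) auto
  define P where "P n \<longleftrightarrow> (\<exists>p. apath x p y \<and> length p = n)" for n
  obtain p0 where "apath x p0 y"
    using assms reachable_apath by blast
  then have "P (length p0)"
    by (auto simp: P_def)
  then have "P (Least P)"
    by (rule LeastI)
  then obtain p where p: "apath x p y" "length p = Least P"
    by (auto simp: P_def)
  have least: "Least P \<le> length q" if "awalk x q y" for q
  proof -
    have "Least P \<le> length (awalk_to_apath q)"
      using apath_awalk_to_apath[OF that] by (intro Least_le) (auto simp: P_def)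
    moreover have "awalk_cost (\<lambda>_. 1) (awalk_to_apath q) \<le> awalk_cost (\<lambda>_. 1) q"
      by (rule awalk_to_path_no_neg_cyc_cost[OF that])
        (simp add: cost)
    ultimately show ?thesis
      by (simp add: cost)
  qed
  have "\<mu> (\<lambda>_. 1) x y = ereal (real (Least P))"
    unfolding \<mu>_def
  proof (rule INF_eqI)
    show "ereal (real (Least P)) \<le> ereal (awalk_cost (\<lambda>_. 1) q)" if "q \<in> {p. awalk x p y}" for q
      using least that by (simp add: cost)
    show "z \<le> ereal (real (Least P))"
      if "\<And>q. q \<in> {p. awalk x p y} \<Longrightarrow> z \<le> ereal (awalk_cost (\<lambda>_. 1) q)" for z
      using that[of p] p by (simp add: cost awalkI_apath)
  qed
  then show ?thesis
    by (simp add: graph_dist_def P_def[abs_def])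
qed

lemma (in fin_digraph) k_metric_dim_attained:
  assumes "k \<in> {1..real (kappa G)}"
  obtains g where "k_resolving_function G k g" "sum g (verts G) = frac_k_metric_dim G k"
    "\<And>h. k_resolving_function G k h \<Longrightarrow> sum g (verts G) \<le> sum h (verts G)"
proof -
  define B :: "'a \<Rightarrow> real set" where "B v = (if v \<in> verts G then {0..1} else {0})" for v
  define D where "D = {(x, y). x \<in> verts G \<and> y \<in> verts G \<and> x \<noteq> y}"
  define K where "K = PiE UNIV B \<inter>
    (\<Inter>(x, y) \<in> D. {g. k \<le> sum g (resolving_set G x y)})"
  have "compactin (product_topology (\<lambda>_. euclidean) UNIV) (PiE UNIV B)"
    unfolding compactin_PiE by (auto simp: B_def)
  then have comp: "compact (PiE UNIV B)"
    by (simp add: euclidean_product_topology)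
  have cont: "continuous_on UNIV (\<lambda>g :: 'a \<Rightarrow> real. sum g A)" for A
    by (intro continuous_intros) (auto intro: continuous_on_product_coordinates)
  have "closed (\<Inter>(x, y) \<in> D. {g. k \<le> sum g (resolving_set G x y)})"
    by (intro closed_INT) (auto intro!: closed_Collect_le cont)
  then have "compact K"
    using comp by (simp add: K_def compact_Int_closed)
  have K_iff: "g \<in> K \<longleftrightarrow> k_resolving_function G k g \<and> (\<forall>v. v \<notin> verts G \<longrightarrow> g v = 0)" for g
    by (auto simp: K_def k_resolving_function_def D_def B_def PiE_UNIV_domain Pi_iff split: if_splits)
  let ?S = "{card (resolving_set G x y) | x y. x \<in> verts G \<and> y \<in> verts G \<and> x \<noteq> y}"
  have "?S = (\<lambda>(x, y). card (resolving_set G x y)) ` D"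
    by (auto simp: D_def)
  moreover have "finite D"
    by (rule finite_subset[of _ "verts G \<times> verts G"]) (auto simp: D_def)
  ultimately have "finite ?S"
    by simp
  then have "kappa G \<le> card (resolving_set G x y)"
    if "x \<in> verts G" "y \<in> verts G" "x \<noteq> y" for x y
    unfolding kappa_def using that by (intro Min_le) auto
  then have "k \<le> real (card (resolving_set G x y))"
    if "x \<in> verts G" "y \<in> verts G" "x \<noteq> y" for x y
    using that assms by fastforce
  moreover have "sum (indicator (verts G)) (resolving_set G x y) =
      real (card (resolving_set G x y))" for x y
    by (subst sum.cong[OF refl, of _ _ "\<lambda>_. 1"]) (auto simp: resolving_set_def)
  ultimately have "indicator (verts G) \<in> K"
    by (auto simp: K_iff k_resolving_function_def)
  then have "K \<noteq> {}"
    by blast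
  from continuous_attains_inf[OF \<open>compact K\<close> this continuous_on_subset[OF cont]]
  obtain g where g: "g \<in> K" "\<And>h. h \<in> K \<Longrightarrow> sum g (verts G) \<le> sum h (verts G)"
    by blast
  have le: "sum g (verts G) \<le> sum h (verts G)" if "k_resolving_function G k h" for h
  proof -
    define h' where "h' v = (if v \<in> verts G then h v else 0)" for v
    have "sum h' A = sum h A" if "A \<subseteq> verts G" for A
      using that by (intro sum.cong) (auto simp: h'_def)
    moreover have "resolving_set G x y \<subseteq> verts G" for x y
      by (auto simp: resolving_set_def)
    ultimately have "h' \<in> K" "sum h' (verts G) = sum h (verts G)"
      using that by (auto simp: K_iff k_resolving_function_def h'_def)
    then show ?thesis
      using g by metis
  qed
  moreover have "sum g (verts G) = frac_k_metric_dim G k"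
    unfolding frac_k_metric_dim_def
    by (rule cInf_eq_minimum[symmetric]) (use g(1) le in \<open>auto simp: K_iff\<close>)
  ultimately show thesis
    using that g(1) by (auto simp: K_iff)
qed

end

theory Submission
  imports Defs
begin

text \<open>The resolving inequalities are linear in the function, so multiplying by a constant
  \<open>c\<close> turns \<open>k\<close>-resolving into \<open>c * k\<close>-resolving; only the
  range [0,1] can obstruct this. Scaling the given minimum resolving function by \<open>k\<close>
  yields the upper bound, and scaling an arbitrary \<open>k\<close>-resolving function by
  \<open>1 / k\<close> yields the lower bound.\<close>

lemma k_resolving_function_scale:
  assumes "k_resolving_function G k g" and "0 \<le> c"
    and "\<And>v. v \<in> verts G \<Longrightarrow> c * g v \<le> 1"
  shows "k_resolving_function G (c * k) (\<lambda>v. c * g v)"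
  using assms
  by (auto simp: k_resolving_function_def Pi_iff mult_left_mono simp flip: sum_distrib_left)

lemma frac_k_metric_dim_le:
  assumes "k_resolving_function G k g"
  shows "frac_k_metric_dim G k \<le> sum g (verts G)"
  unfolding frac_k_metric_dim_def
proof (rule cInf_lower)
  show "bdd_below {sum g (verts G) | g. k_resolving_function G k g}"
    by (rule bdd_belowI[of _ 0]) (auto simp: k_resolving_function_def Pi_iff intro!: sum_nonneg)
qed (use assms in blast)

theorem lemma3p2:
  fixes G :: "('a, 'b) pre_digraph" and k :: real
  assumes "graph G"
    and "Digraph_Component.connected G"
    and "2 \<le> card (verts G)"
    and "k \<in> {1..real (kappa G)}"
    and "\<exists>g. minimum_resolving_function G g \<and> (\<forall>v \<in> verts G. g v \<le> 1 / k)"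
  shows "frac_k_metric_dim G k = k * frac_metric_dim G"
proof (rule antisym)
  have k: "1 \<le> k"
    using assms(4) by simp
  obtain g where g: "resolving_function G g" "sum g (verts G) = frac_metric_dim G"
    and le: "\<And>v. v \<in> verts G \<Longrightarrow> g v \<le> 1 / k"
    using assms(5) by (auto simp: minimum_resolving_function_def)
  \<comment> \<open>The bound \<open>1 / k\<close> on \<open>g\<close> is exactly what keeps
    \<open>k * g\<close> at most 1.\<close>
  have kg: "k_resolving_function G k (\<lambda>v. k * g v)"
    using k_resolving_function_scale[OF g(1), of k] k le by (simp add: field_simps)
  show "frac_k_metric_dim G k \<le> k * frac_metric_dim G"
    using frac_k_metric_dim_le[OF kg] g(2) by (simp flip: sum_distrib_left)
  have "k * frac_metric_dim G \<le> sum h (verts G)" if h: "k_resolving_function G k h" for h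
  proof -
    \<comment> \<open>Since \<open>h\<close> is at most 1 and \<open>k\<close> at least 1, dividing
      by \<open>k\<close> stays within [0,1].\<close>
    have "h v \<le> k" if "v \<in> verts G" for v
      using h k that by (fastforce simp: k_resolving_function_def Pi_iff)
    then have "resolving_function G (\<lambda>v. 1 / k * h v)"
      using k_resolving_function_scale[OF h, of "1 / k"] k by (simp add: field_simps)
    from frac_k_metric_dim_le[OF this] show ?thesis
      using k by (simp add: field_simps flip: sum_divide_distrib)
  qed
  \<comment> \<open>The function \<open>k * g\<close> also witnesses that the set of totals is
    nonempty, so a lower bound of all totals is a lower bound of their real infimum.\<close>
  then show "k * frac_metric_dim G \<le> frac_k_metric_dim G k"
    unfolding frac_k_metric_dim_def[of G k] using kg by (intro cInf_greatest) auto
qed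

end
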